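(* For a precartesian bicategory $\mathbf{B}$, the object $I$ of $\mathbf{B}$, the arrow $\top:I\to I$, and the 2-cells $\widetilde I:\top\top\to\top$ and $I^\circ:1_I\to\top$ constitute a lax functor $I:\mathbf{1}\to\mathbf{B}$.
   Context: Conventions. All bicategories are normal (unit constraints are identities). A lax functor is a morphism of bicategories; a lax functor $\mathbf{1}\to\mathbf{B}$ amounts to an object of $\mathbf{B}$ with a monad on it. A map is an arrow with a right adjoint; $\mathrm{Map}\,\mathbf{B}$ is the locally full subbicategory of $\mathbf{B}$ with all objects and with the maps as arrows. $\mathbf{B}$ is precartesian if (i) $\mathrm{Map}\,\mathbf{B}$ has finite products in the bilimit sense (universal properties given by equivalences of hom-categories), and (ii) each category $\mathbf{B}(X,Y)$ has finite products. Here $I$ is the terminal object of $\mathrm{Map}\,\mathbf{B}$ (i.e. $\mathrm{Map}\,\mathbf{B}(Z,I)\to\mathbf{1}$ is an equivalence for all $Z$), $\top=\top_{I,I}$ is the terminal object of the category $\mathbf{B}(I,I)$, and $\widetilde I$, $I^\circ$ are the unique 2-cells $\top\top\to\top$ and $1_I\to\top$ into it. *)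

theory Defs
  imports Main
begin

section \<open>Categories\<close>

record ('o, 'm) cat =
  Obj :: "'o set"
  Mor :: "'m set"
  Dom :: "'m \<Rightarrow> 'o"
  Cod :: "'m \<Rightarrow> 'o"
  Ide :: "'o \<Rightarrow> 'm"
  Cmp :: "'m \<Rightarrow> 'm \<Rightarrow> 'm" (infixl "\<cdot>\<index>" 70)

definition homs :: "('o, 'm) cat \<Rightarrow> 'o \<Rightarrow> 'o \<Rightarrow> 'm set" where
  "homs C x y = {m \<in> Mor C. Dom C m = x \<and> Cod C m = y}"

locale category =
  fixes C :: "('o, 'm) cat" (structure)
  assumes Dom_in: "m \<in> Mor C \<Longrightarrow> Dom C m \<in> Obj C"
    and Cod_in: "m \<in> Mor C \<Longrightarrow> Cod C m \<in> Obj C"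
    and Ide_in: "x \<in> Obj C \<Longrightarrow> Ide C x \<in> homs C x x"
    and Cmp_in: "\<lbrakk>m \<in> homs C x y; n \<in> homs C y z\<rbrakk> \<Longrightarrow> n \<cdot> m \<in> homs C x z"
    and Cmp_Ide_left: "m \<in> homs C x y \<Longrightarrow> Ide C y \<cdot> m = m"
    and Cmp_Ide_right: "m \<in> homs C x y \<Longrightarrow> m \<cdot> Ide C x = m"
    and Cmp_assoc: "\<lbrakk>k \<in> homs C w x; m \<in> homs C x y; n \<in> homs C y z\<rbrakk>
      \<Longrightarrow> (n \<cdot> m) \<cdot> k = n \<cdot> (m \<cdot> k)"

definition inverses :: "('o, 'm) cat \<Rightarrow> 'm \<Rightarrow> 'm \<Rightarrow> bool" where
  "inverses C m n \<longleftrightarrow> m \<in> Mor C \<and> n \<in> homs C (Cod C m) (Dom C m)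
     \<and> n \<cdot>\<^bsub>C\<^esub> m = Ide C (Dom C m) \<and> m \<cdot>\<^bsub>C\<^esub> n = Ide C (Cod C m)"

definition iso :: "('o, 'm) cat \<Rightarrow> 'm \<Rightarrow> bool" where
  "iso C m \<longleftrightarrow> (\<exists>n. inverses C m n)"

definition inv_mor :: "('o, 'm) cat \<Rightarrow> 'm \<Rightarrow> 'm" where
  "inv_mor C m = (THE n. inverses C m n)"

definition terminal :: "('o, 'm) cat \<Rightarrow> 'o \<Rightarrow> bool" where
  "terminal C t \<longleftrightarrow> t \<in> Obj C \<and> (\<forall>x\<in>Obj C. \<exists>!m. m \<in> homs C x t)"

text \<open>The unique morphism from \<open>x\<close> into a terminal object \<open>t\<close>.\<close>

definition to_terminal :: "('o, 'm) cat \<Rightarrow> 'o \<Rightarrow> 'o \<Rightarrow> 'm" where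
  "to_terminal C x t = (THE m. m \<in> homs C x t)"

definition binary_product ::
  "('o, 'm) cat \<Rightarrow> 'o \<Rightarrow> 'o \<Rightarrow> 'o \<Rightarrow> 'm \<Rightarrow> 'm \<Rightarrow> bool" where
  "binary_product C x y q p r \<longleftrightarrow> p \<in> homs C q x \<and> r \<in> homs C q y
     \<and> (\<forall>z\<in>Obj C. \<forall>m\<in>homs C z x. \<forall>n\<in>homs C z y.
          \<exists>!h. h \<in> homs C z q \<and> p \<cdot>\<^bsub>C\<^esub> h = m \<and> r \<cdot>\<^bsub>C\<^esub> h = n)"

definition has_finite_products :: "('o, 'm) cat \<Rightarrow> bool" where
  "has_finite_products C \<longleftrightarrow> (\<exists>t. terminal C t)
     \<and> (\<forall>x\<in>Obj C. \<forall>y\<in>Obj C. \<exists>q p r. binary_product C x y q p r)"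

definition full_subcat :: "('o, 'm) cat \<Rightarrow> ('o \<Rightarrow> bool) \<Rightarrow> ('o, 'm) cat" where
  "full_subcat C P = C\<lparr>Obj := {x \<in> Obj C. P x},
                       Mor := {m \<in> Mor C. P (Dom C m) \<and> P (Cod C m)}\<rparr>"

definition unit_cat :: "(unit, unit) cat" where
  "unit_cat = \<lparr>Obj = {()}, Mor = {()}, Dom = (\<lambda>_. ()), Cod = (\<lambda>_. ()),
               Ide = (\<lambda>_. ()), Cmp = (\<lambda>_ _. ())\<rparr>"

definition prod_cat :: "('o, 'm) cat \<Rightarrow> ('p, 'n) cat \<Rightarrow> ('o \<times> 'p, 'm \<times> 'n) cat" where
  "prod_cat C D = \<lparr>Obj = Obj C \<times> Obj D, Mor = Mor C \<times> Mor D,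
     Dom = map_prod (Dom C) (Dom D), Cod = map_prod (Cod C) (Cod D),
     Ide = map_prod (Ide C) (Ide D),
     Cmp = (\<lambda>(n, n') (m, m'). (n \<cdot>\<^bsub>C\<^esub> m, n' \<cdot>\<^bsub>D\<^esub> m'))\<rparr>"

locale cat_functor = C: category C + D: category D
  for C :: "('o, 'm) cat" and D :: "('p, 'n) cat" +
  fixes Fo :: "'o \<Rightarrow> 'p" and Fm :: "'m \<Rightarrow> 'n"
  assumes Fo_in: "x \<in> Obj C \<Longrightarrow> Fo x \<in> Obj D"
    and Fm_in: "m \<in> homs C x y \<Longrightarrow> Fm m \<in> homs D (Fo x) (Fo y)"
    and Fm_Ide: "x \<in> Obj C \<Longrightarrow> Fm (Ide C x) = Ide D (Fo x)"
    and Fm_Cmp: "\<lbrakk>m \<in> homs C x y; n \<in> homs C y z\<rbrakk>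
      \<Longrightarrow> Fm (n \<cdot>\<^bsub>C\<^esub> m) = Fm n \<cdot>\<^bsub>D\<^esub> Fm m"

locale nat_iso = F: cat_functor C D Fo Fm + G: cat_functor C D Go Gm
  for C :: "('o, 'm) cat" and D :: "('p, 'n) cat" and Fo Fm Go Gm +
  fixes t :: "'o \<Rightarrow> 'n"
  assumes component_in: "x \<in> Obj C \<Longrightarrow> t x \<in> homs D (Fo x) (Go x)"
    and component_iso: "x \<in> Obj C \<Longrightarrow> iso D (t x)"
    and natural: "m \<in> homs C x y \<Longrightarrow> t y \<cdot>\<^bsub>D\<^esub> Fm m = Gm m \<cdot>\<^bsub>D\<^esub> t x"

definition equivalence ::
  "('o, 'm) cat \<Rightarrow> ('p, 'n) cat \<Rightarrow> ('o \<Rightarrow> 'p) \<Rightarrow> ('m \<Rightarrow> 'n) \<Rightarrow> bool" where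
  "equivalence C D Fo Fm \<longleftrightarrow> cat_functor C D Fo Fm
     \<and> (\<exists>Go Gm. cat_functor D C Go Gm
          \<and> (\<exists>s. nat_iso C C id id (Go \<circ> Fo) (Gm \<circ> Fm) s)
          \<and> (\<exists>t. nat_iso D D (Fo \<circ> Go) (Fm \<circ> Gm) id id t))"

section \<open>Bicategories\<close>

text \<open>
  Composition and constraints are not indexed by objects: distinct hom-categories are
  meant to have distinctly labelled arrows and 2-cells, although no axiom needs this.
  Composition is written in applicative order, and the constraints are
  \<open>Asc h g f : (h g) f \<rightarrow> h (g f)\<close>, \<open>LUn f : 1 f \<rightarrow> f\<close> and \<open>RUn f : f 1 \<rightarrow> f\<close>.
\<close>

record ('o, 'a, 'c) bicat =
  Ob :: "'o set"
  Hom :: "'o \<Rightarrow> 'o \<Rightarrow> ('a, 'c) cat"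
  One :: "'o \<Rightarrow> 'a"
  HCmp :: "'a \<Rightarrow> 'a \<Rightarrow> 'a" (infixr "\<odot>\<index>" 75)
  HCmp2 :: "'c \<Rightarrow> 'c \<Rightarrow> 'c" (infixr "\<star>\<index>" 75)
  Asc :: "'a \<Rightarrow> 'a \<Rightarrow> 'a \<Rightarrow> 'c"
  LUn :: "'a \<Rightarrow> 'c"
  RUn :: "'a \<Rightarrow> 'c"

abbreviation arrs :: "('o, 'a, 'c) bicat \<Rightarrow> 'o \<Rightarrow> 'o \<Rightarrow> 'a set" where
  "arrs B X Y \<equiv> Obj (Hom B X Y)"

locale bicategory =
  fixes B :: "('o, 'a, 'c) bicat" (structure)
  assumes Hom_category: "\<lbrakk>X \<in> Ob B; Y \<in> Ob B\<rbrakk> \<Longrightarrow> category (Hom B X Y)"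
    and One_in: "X \<in> Ob B \<Longrightarrow> One B X \<in> arrs B X X"
    and HCmp_functor: "\<lbrakk>X \<in> Ob B; Y \<in> Ob B; Z \<in> Ob B\<rbrakk>
      \<Longrightarrow> cat_functor (prod_cat (Hom B Y Z) (Hom B X Y)) (Hom B X Z)
            (\<lambda>(g, f). g \<odot> f) (\<lambda>(\<beta>, \<alpha>). \<beta> \<star> \<alpha>)"
    and Asc_nat_iso: "\<lbrakk>W \<in> Ob B; X \<in> Ob B; Y \<in> Ob B; Z \<in> Ob B\<rbrakk>
      \<Longrightarrow> nat_iso (prod_cat (Hom B Y Z) (prod_cat (Hom B X Y) (Hom B W X))) (Hom B W Z)
            (\<lambda>(h, g, f). (h \<odot> g) \<odot> f) (\<lambda>(\<gamma>, \<beta>, \<alpha>). (\<gamma> \<star> \<beta>) \<star> \<alpha>)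
            (\<lambda>(h, g, f). h \<odot> (g \<odot> f)) (\<lambda>(\<gamma>, \<beta>, \<alpha>). \<gamma> \<star> (\<beta> \<star> \<alpha>))
            (\<lambda>(h, g, f). Asc B h g f)"
    and LUn_nat_iso: "\<lbrakk>X \<in> Ob B; Y \<in> Ob B\<rbrakk>
      \<Longrightarrow> nat_iso (Hom B X Y) (Hom B X Y)
            (\<lambda>f. One B Y \<odot> f) (\<lambda>\<alpha>. Ide (Hom B Y Y) (One B Y) \<star> \<alpha>) id id (LUn B)"
    and RUn_nat_iso: "\<lbrakk>X \<in> Ob B; Y \<in> Ob B\<rbrakk>
      \<Longrightarrow> nat_iso (Hom B X Y) (Hom B X Y)
            (\<lambda>f. f \<odot> One B X) (\<lambda>\<alpha>. \<alpha> \<star> Ide (Hom B X X) (One B X)) id id (RUn B)"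
    and pentagon: "\<lbrakk>V \<in> Ob B; W \<in> Ob B; X \<in> Ob B; Y \<in> Ob B; Z \<in> Ob B;
        f \<in> arrs B V W; g \<in> arrs B W X; h \<in> arrs B X Y; k \<in> arrs B Y Z\<rbrakk>
      \<Longrightarrow> Asc B k h (g \<odot> f) \<cdot>\<^bsub>Hom B V Z\<^esub> Asc B (k \<odot> h) g f
        = (Ide (Hom B Y Z) k \<star> Asc B h g f) \<cdot>\<^bsub>Hom B V Z\<^esub> Asc B k (h \<odot> g) f
            \<cdot>\<^bsub>Hom B V Z\<^esub> (Asc B k h g \<star> Ide (Hom B V W) f)"
    and triangle: "\<lbrakk>X \<in> Ob B; Y \<in> Ob B; Z \<in> Ob B; f \<in> arrs B X Y; g \<in> arrs B Y Z\<rbrakk>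
      \<Longrightarrow> (Ide (Hom B Y Z) g \<star> LUn B f) \<cdot>\<^bsub>Hom B X Z\<^esub> Asc B g (One B Y) f
        = RUn B g \<star> Ide (Hom B X Y) f"

text \<open>
  The equations below are between 2-cells of a hom-category, so comparing domains they
  also give \<open>1 f = f\<close> and \<open>f 1 = f\<close>.
\<close>

locale normal_bicategory = bicategory B for B :: "('o, 'a, 'c) bicat" +
  assumes LUn_Ide: "\<lbrakk>X \<in> Ob B; Y \<in> Ob B; f \<in> arrs B X Y\<rbrakk> \<Longrightarrow> LUn B f = Ide (Hom B X Y) f"
    and RUn_Ide: "\<lbrakk>X \<in> Ob B; Y \<in> Ob B; f \<in> arrs B X Y\<rbrakk> \<Longrightarrow> RUn B f = Ide (Hom B X Y) f"

definition unit_bicat :: "(unit, unit, unit) bicat" where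
  "unit_bicat = \<lparr>Ob = {()}, Hom = (\<lambda>_ _. unit_cat), One = (\<lambda>_. ()), HCmp = (\<lambda>_ _. ()),
     HCmp2 = (\<lambda>_ _. ()), Asc = (\<lambda>_ _ _. ()), LUn = (\<lambda>_. ()), RUn = (\<lambda>_. ())\<rparr>"

section \<open>Maps\<close>

text \<open>
  \<open>f : X \<rightarrow> Y\<close> is left adjoint to \<open>g : Y \<rightarrow> X\<close> with unit \<open>\<eta> : 1 \<rightarrow> g f\<close> and
  counit \<open>\<epsilon> : f g \<rightarrow> 1\<close>.
\<close>

definition adjunction ::
  "('o, 'a, 'c) bicat \<Rightarrow> 'o \<Rightarrow> 'o \<Rightarrow> 'a \<Rightarrow> 'a \<Rightarrow> 'c \<Rightarrow> 'c \<Rightarrow> bool" where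
  "adjunction B X Y f g \<eta> \<epsilon> \<longleftrightarrow>
     f \<in> arrs B X Y \<and> g \<in> arrs B Y X
   \<and> \<eta> \<in> homs (Hom B X X) (One B X) (g \<odot>\<^bsub>B\<^esub> f)
   \<and> \<epsilon> \<in> homs (Hom B Y Y) (f \<odot>\<^bsub>B\<^esub> g) (One B Y)
   \<and> LUn B f \<cdot>\<^bsub>Hom B X Y\<^esub> (\<epsilon> \<star>\<^bsub>B\<^esub> Ide (Hom B X Y) f)
       \<cdot>\<^bsub>Hom B X Y\<^esub> inv_mor (Hom B X Y) (Asc B f g f)
       \<cdot>\<^bsub>Hom B X Y\<^esub> (Ide (Hom B X Y) f \<star>\<^bsub>B\<^esub> \<eta>)
       \<cdot>\<^bsub>Hom B X Y\<^esub> inv_mor (Hom B X Y) (RUn B f) = Ide (Hom B X Y) f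
   \<and> RUn B g \<cdot>\<^bsub>Hom B Y X\<^esub> (Ide (Hom B Y X) g \<star>\<^bsub>B\<^esub> \<epsilon>)
       \<cdot>\<^bsub>Hom B Y X\<^esub> Asc B g f g
       \<cdot>\<^bsub>Hom B Y X\<^esub> (\<eta> \<star>\<^bsub>B\<^esub> Ide (Hom B Y X) g)
       \<cdot>\<^bsub>Hom B Y X\<^esub> inv_mor (Hom B Y X) (LUn B g) = Ide (Hom B Y X) g"

definition is_map :: "('o, 'a, 'c) bicat \<Rightarrow> 'o \<Rightarrow> 'o \<Rightarrow> 'a \<Rightarrow> bool" where
  "is_map B X Y f \<longleftrightarrow> (\<exists>g \<eta> \<epsilon>. adjunction B X Y f g \<eta> \<epsilon>)"

definition Map_bicat :: "('o, 'a, 'c) bicat \<Rightarrow> ('o, 'a, 'c) bicat" where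
  "Map_bicat B = B\<lparr>Hom := \<lambda>X Y. full_subcat (Hom B X Y) (is_map B X Y)\<rparr>"

section \<open>Finite products of bicategories and precartesian bicategories\<close>

definition biterminal :: "('o, 'a, 'c) bicat \<Rightarrow> 'o \<Rightarrow> bool" where
  "biterminal B I \<longleftrightarrow> I \<in> Ob B
     \<and> (\<forall>Z\<in>Ob B. equivalence (Hom B Z I) unit_cat (\<lambda>_. ()) (\<lambda>_. ()))"

definition binary_biproduct ::
  "('o, 'a, 'c) bicat \<Rightarrow> 'o \<Rightarrow> 'o \<Rightarrow> 'o \<Rightarrow> 'a \<Rightarrow> 'a \<Rightarrow> bool" where
  "binary_biproduct B X Y P p r \<longleftrightarrow> P \<in> Ob B \<and> p \<in> arrs B P X \<and> r \<in> arrs B P Y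
     \<and> (\<forall>Z\<in>Ob B. equivalence (Hom B Z P) (prod_cat (Hom B Z X) (Hom B Z Y))
          (\<lambda>h. (p \<odot>\<^bsub>B\<^esub> h, r \<odot>\<^bsub>B\<^esub> h))
          (\<lambda>\<alpha>. (Ide (Hom B P X) p \<star>\<^bsub>B\<^esub> \<alpha>, Ide (Hom B P Y) r \<star>\<^bsub>B\<^esub> \<alpha>)))"

definition has_finite_biproducts :: "('o, 'a, 'c) bicat \<Rightarrow> bool" where
  "has_finite_biproducts B \<longleftrightarrow> (\<exists>I. biterminal B I)
     \<and> (\<forall>X\<in>Ob B. \<forall>Y\<in>Ob B. \<exists>P p r. binary_biproduct B X Y P p r)"

locale precartesian_bicategory = normal_bicategory B for B :: "('o, 'a, 'c) bicat" +
  assumes Map_products: "has_finite_biproducts (Map_bicat B)"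
    and Hom_products: "\<lbrakk>X \<in> Ob B; Y \<in> Ob B\<rbrakk> \<Longrightarrow> has_finite_products (Hom B X Y)"

section \<open>Lax functors\<close>

text \<open>
  Morphisms of bicategories: \<open>Fc g f : (F g) (F f) \<rightarrow> F (g f)\<close> and
  \<open>Fu X : 1 \<rightarrow> F 1\<close> are not required to be invertible.
\<close>

locale lax_functor = A: bicategory A + B: bicategory B
  for A :: "('o, 'a, 'c) bicat" and B :: "('p, 'b, 'd) bicat" +
  fixes F0 :: "'o \<Rightarrow> 'p" and F1 :: "'a \<Rightarrow> 'b" and F2 :: "'c \<Rightarrow> 'd"
    and Fc :: "'a \<Rightarrow> 'a \<Rightarrow> 'd" and Fu :: "'o \<Rightarrow> 'd"
  assumes F0_in: "X \<in> Ob A \<Longrightarrow> F0 X \<in> Ob B"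
    and F_functor: "\<lbrakk>X \<in> Ob A; Y \<in> Ob A\<rbrakk>
      \<Longrightarrow> cat_functor (Hom A X Y) (Hom B (F0 X) (F0 Y)) F1 F2"
    and Fc_in: "\<lbrakk>X \<in> Ob A; Y \<in> Ob A; Z \<in> Ob A; f \<in> arrs A X Y; g \<in> arrs A Y Z\<rbrakk>
      \<Longrightarrow> Fc g f \<in> homs (Hom B (F0 X) (F0 Z)) (F1 g \<odot>\<^bsub>B\<^esub> F1 f) (F1 (g \<odot>\<^bsub>A\<^esub> f))"
    and Fc_natural: "\<lbrakk>X \<in> Ob A; Y \<in> Ob A; Z \<in> Ob A;
        \<alpha> \<in> homs (Hom A X Y) f f'; \<beta> \<in> homs (Hom A Y Z) g g'\<rbrakk>
      \<Longrightarrow> Fc g' f' \<cdot>\<^bsub>Hom B (F0 X) (F0 Z)\<^esub> (F2 \<beta> \<star>\<^bsub>B\<^esub> F2 \<alpha>)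
        = F2 (\<beta> \<star>\<^bsub>A\<^esub> \<alpha>) \<cdot>\<^bsub>Hom B (F0 X) (F0 Z)\<^esub> Fc g f"
    and Fu_in: "X \<in> Ob A
      \<Longrightarrow> Fu X \<in> homs (Hom B (F0 X) (F0 X)) (One B (F0 X)) (F1 (One A X))"
    and Fc_assoc: "\<lbrakk>W \<in> Ob A; X \<in> Ob A; Y \<in> Ob A; Z \<in> Ob A;
        f \<in> arrs A W X; g \<in> arrs A X Y; h \<in> arrs A Y Z\<rbrakk>
      \<Longrightarrow> F2 (Asc A h g f) \<cdot>\<^bsub>Hom B (F0 W) (F0 Z)\<^esub> Fc (h \<odot>\<^bsub>A\<^esub> g) f
            \<cdot>\<^bsub>Hom B (F0 W) (F0 Z)\<^esub> (Fc h g \<star>\<^bsub>B\<^esub> Ide (Hom B (F0 W) (F0 X)) (F1 f))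
        = Fc h (g \<odot>\<^bsub>A\<^esub> f)
            \<cdot>\<^bsub>Hom B (F0 W) (F0 Z)\<^esub> (Ide (Hom B (F0 Y) (F0 Z)) (F1 h) \<star>\<^bsub>B\<^esub> Fc g f)
            \<cdot>\<^bsub>Hom B (F0 W) (F0 Z)\<^esub> Asc B (F1 h) (F1 g) (F1 f)"
    and Fu_left: "\<lbrakk>X \<in> Ob A; Y \<in> Ob A; f \<in> arrs A X Y\<rbrakk>
      \<Longrightarrow> F2 (LUn A f) \<cdot>\<^bsub>Hom B (F0 X) (F0 Y)\<^esub> Fc (One A Y) f
            \<cdot>\<^bsub>Hom B (F0 X) (F0 Y)\<^esub> (Fu Y \<star>\<^bsub>B\<^esub> Ide (Hom B (F0 X) (F0 Y)) (F1 f))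
        = LUn B (F1 f)"
    and Fu_right: "\<lbrakk>X \<in> Ob A; Y \<in> Ob A; f \<in> arrs A X Y\<rbrakk>
      \<Longrightarrow> F2 (RUn A f) \<cdot>\<^bsub>Hom B (F0 X) (F0 Y)\<^esub> Fc f (One A X)
            \<cdot>\<^bsub>Hom B (F0 X) (F0 Y)\<^esub> (Ide (Hom B (F0 X) (F0 Y)) (F1 f) \<star>\<^bsub>B\<^esub> Fu X)
        = RUn B (F1 f)"

end

theory Submission
  imports Defs
begin

text \<open>
  Every lax functor axiom is an equation between parallel 2-cells with codomain the terminal
  object \<open>\<top>\<close> of \<open>B(I, I)\<close>, so only typing has to be checked.
\<close>

lemma terminal_unique:
  assumes "terminal C t" "x \<in> Obj C" "m \<in> homs C x t" "n \<in> homs C x t"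
  shows "m = n"
  using assms unfolding terminal_def by blast

lemma to_terminal_in:
  assumes "terminal C t" "x \<in> Obj C"
  shows "to_terminal C x t \<in> homs C x t"
  using assms unfolding terminal_def to_terminal_def by (metis theI')

lemma category_unit_cat: "category unit_cat"
  by unfold_locales (auto simp: unit_cat_def homs_def)

text \<open>Horizontal composition and the associator of \<open>unit_bicat\<close> have product
  categories as sources; these must be categories for the functor axioms there.\<close>

lemma category_prod_cat:
  assumes "category C" "category D"
  shows "category (prod_cat C D)"
proof -
  interpret C: category C by fact
  interpret D: category D by fact
  show ?thesis
    using C.Dom_in C.Cod_in C.Ide_in C.Cmp_in C.Cmp_Ide_left C.Cmp_Ide_right C.Cmp_assoc
      D.Dom_in D.Cod_in D.Ide_in D.Cmp_in D.Cmp_Ide_left D.Cmp_Ide_right D.Cmp_assoc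
    by unfold_locales (auto simp: prod_cat_def homs_def)
qed

lemma cat_functor_unit_cat:
  assumes "category C"
  shows "cat_functor C unit_cat F Fm"
  using assms category_unit_cat
  by (auto simp: cat_functor_def cat_functor_axioms_def unit_cat_def homs_def)

text \<open>The only morphism of \<open>unit_cat\<close> is its own inverse and all its composites
  agree, so any data qualify. This supplies the associator and unit constraints of
  \<open>unit_bicat\<close>.\<close>

lemma nat_iso_unit_cat:
  assumes "category C"
  shows "nat_iso C unit_cat F Fm G Gm t"
  using cat_functor_unit_cat[OF assms]
  by (auto simp: nat_iso_def nat_iso_axioms_def iso_def inverses_def unit_cat_def homs_def)

lemma bicategory_unit_bicat: "bicategory unit_bicat"
  by (rule bicategory.intro)
    (auto simp: unit_bicat_def category_unit_cat category_prod_cat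
      cat_functor_unit_cat nat_iso_unit_cat, simp add: unit_cat_def)

text \<open>Preservation of composition is just idempotence of the identity. This is the action on
  homs of the lax functor, picking out the arrow of the monad.\<close>

lemma cat_functor_from_unit_cat:
  assumes "category C" "x \<in> Obj C"
  shows "cat_functor unit_cat C (\<lambda>_. x) (\<lambda>_. Ide C x)"
proof -
  interpret C: category C by fact
  show ?thesis
    using C.Ide_in[OF assms(2)] category_unit_cat assms
    by (auto simp: cat_functor_def cat_functor_axioms_def C.Cmp_Ide_left)
qed

context bicategory
begin

text \<open>This and the next four lemmas are typing rules, read off from the functor and natural
  isomorphism axioms at suitable tuples or arrows.\<close>

lemma HCmp_in:
  assumes "X \<in> Ob B" "Y \<in> Ob B" "Z \<in> Ob B" "g \<in> arrs B Y Z" "f \<in> arrs B X Y"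
  shows "g \<odot> f \<in> arrs B X Z"
  using cat_functor.Fo_in[OF HCmp_functor[OF assms(1-3)], of "(g, f)"] assms
  by (auto simp: prod_cat_def)

lemma HCmp2_in:
  assumes "X \<in> Ob B" "Y \<in> Ob B" "Z \<in> Ob B"
    and "\<beta> \<in> homs (Hom B Y Z) g g'" "\<alpha> \<in> homs (Hom B X Y) f f'"
  shows "\<beta> \<star> \<alpha> \<in> homs (Hom B X Z) (g \<odot> f) (g' \<odot> f')"
  using cat_functor.Fm_in[OF HCmp_functor[OF assms(1-3)], of "(\<beta>, \<alpha>)" "(g, f)" "(g', f')"] assms
  by (auto simp: prod_cat_def homs_def)

lemma Asc_in:
  assumes "W \<in> Ob B" "X \<in> Ob B" "Y \<in> Ob B" "Z \<in> Ob B"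
    and "h \<in> arrs B Y Z" "g \<in> arrs B X Y" "f \<in> arrs B W X"
  shows "Asc B h g f \<in> homs (Hom B W Z) ((h \<odot> g) \<odot> f) (h \<odot> (g \<odot> f))"
  using nat_iso.component_in[OF Asc_nat_iso[OF assms(1-4)], of "(h, g, f)"] assms
  by (auto simp: prod_cat_def)

lemma LUn_in:
  assumes "X \<in> Ob B" "Y \<in> Ob B" "f \<in> arrs B X Y"
  shows "LUn B f \<in> homs (Hom B X Y) (One B Y \<odot> f) f"
  using nat_iso.component_in[OF LUn_nat_iso[OF assms(1,2)] assms(3)] by simp

lemma RUn_in:
  assumes "X \<in> Ob B" "Y \<in> Ob B" "f \<in> arrs B X Y"
  shows "RUn B f \<in> homs (Hom B X Y) (f \<odot> One B X) f"
  using nat_iso.component_in[OF RUn_nat_iso[OF assms(1,2)] assms(3)] by simp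

text \<open>Terminality forces both structure 2-cells. As the source has one object, one arrow and
  one 2-cell, the equations on them reduce to naturality, associativity and two unit laws.\<close>

lemma lax_functor_terminal:
  assumes I: "I \<in> Ob B" and T: "terminal (Hom B I I) T"
  shows "lax_functor unit_bicat B
    (\<lambda>_. I) (\<lambda>_. T) (\<lambda>_. Ide (Hom B I I) T)
    (\<lambda>_ _. to_terminal (Hom B I I) (T \<odot> T) T)
    (\<lambda>_. to_terminal (Hom B I I) (One B I) T)"
proof -
  let ?H = "Hom B I I"
  let ?\<mu> = "to_terminal ?H (T \<odot> T) T" and ?\<eta> = "to_terminal ?H (One B I) T"
  let ?i = "Ide ?H T"
  interpret H: category ?H by (rule Hom_category[OF I I])
  have T_in: "T \<in> Obj ?H" using T by (simp add: terminal_def)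
  \<comment> \<open>Domains of the parallel 2-cells compared below: \<open>T \<odot> T\<close> for
    naturality, the other two for the unit laws.\<close>
  have TT: "T \<odot> T \<in> Obj ?H" and T1: "T \<odot> One B I \<in> Obj ?H" and oneT: "One B I \<odot> T \<in> Obj ?H"
    using HCmp_in[OF I I I] T_in One_in[OF I] by auto
  have TTT: "(T \<odot> T) \<odot> T \<in> Obj ?H" using HCmp_in[OF I I I TT T_in] .
  have i: "?i \<in> homs ?H T T" using H.Ide_in[OF T_in] .
  have \<mu>: "?\<mu> \<in> homs ?H (T \<odot> T) T" using to_terminal_in[OF T TT] .
  have \<eta>: "?\<eta> \<in> homs ?H (One B I) T" using to_terminal_in[OF T One_in[OF I]] .
  \<comment> \<open>\<open>H.Cmp_in\<close> types the right factor first, so unification finds each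
    intermediate arrow from the known domain.\<close>
  note cell = H.Cmp_in HCmp2_in[OF I I I] Asc_in[OF I I I I T_in T_in T_in]
    LUn_in[OF I I T_in] RUn_in[OF I I T_in] i \<mu> \<eta>
  note uniq = terminal_unique[OF T]
  have nat: "?\<mu> \<cdot>\<^bsub>?H\<^esub> (?i \<star> ?i) = ?i \<cdot>\<^bsub>?H\<^esub> ?\<mu>"
    by (rule uniq[OF TT]) (rule cell)+
  \<comment> \<open>Here, and in the unit laws below, the leading \<open>?i\<close> is the image of
    a constraint of \<open>unit_bicat\<close>.\<close>
  have assoc: "?i \<cdot>\<^bsub>?H\<^esub> ?\<mu> \<cdot>\<^bsub>?H\<^esub> (?\<mu> \<star> ?i) = ?\<mu> \<cdot>\<^bsub>?H\<^esub> (?i \<star> ?\<mu>) \<cdot>\<^bsub>?H\<^esub> Asc B T T T"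
    by (rule uniq[OF TTT]) (rule cell)+
  have left: "?i \<cdot>\<^bsub>?H\<^esub> ?\<mu> \<cdot>\<^bsub>?H\<^esub> (?\<eta> \<star> ?i) = LUn B T"
    by (rule uniq[OF oneT]) (rule cell)+
  have right: "?i \<cdot>\<^bsub>?H\<^esub> ?\<mu> \<cdot>\<^bsub>?H\<^esub> (?i \<star> ?\<eta>) = RUn B T"
    by (rule uniq[OF T1]) (rule cell)+
  show ?thesis
    unfolding lax_functor_def lax_functor_axioms_def
    using bicategory_unit_bicat bicategory_axioms I \<mu> \<eta> nat assoc left right
      cat_functor_from_unit_cat[OF Hom_category[OF I I] T_in]
    by (simp add: unit_bicat_def)
qed

end

theorem proposition3p18:
  fixes B :: "('o, 'a, 'c) bicat" and I :: 'o and T :: 'a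
  assumes "precartesian_bicategory B"
    and "biterminal (Map_bicat B) I"
    and "terminal (Hom B I I) T"
  shows "lax_functor unit_bicat B
    (\<lambda>_. I) (\<lambda>_. T) (\<lambda>_. Ide (Hom B I I) T)
    (\<lambda>_ _. to_terminal (Hom B I I) (T \<odot>\<^bsub>B\<^esub> T) T)
    (\<lambda>_. to_terminal (Hom B I I) (One B I) T)"
proof -
  interpret precartesian_bicategory B by fact
  \<comment> \<open>\<open>Map_bicat\<close> changes only the hom-categories, so its objects are
    those of \<open>B\<close>.\<close>
  have "I \<in> Ob B" using assms(2) by (simp add: biterminal_def Map_bicat_def)
  then show ?thesis using assms(3) by (rule lax_functor_terminal)
qed

end
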